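(* Let $\bm{f}\in\mathbb{R}^N_+$, let $\bm{A}=\bm{A_1}+\bm{A_2}$ be the discretised two-dimensional osmosis operator with its dimensional splitting as defined in the context, denote by $a^1_{p,p}$ and $a^2_{p,p}$ ($p=1,\dots,N$) the diagonal entries of $\bm{A_1}$ and $\bm{A_2}$ respectively, and let $$0<\tau < 2\Bigl(\max\bigl\{ \max_{p} |a^1_{p,p}| ,\ \max_{p} |a^2_{p,p}| \bigr\}\Bigr)^{-1}.$$ Let $(\bm{u}^k)_{k\ge 0}$ be defined by $\bm{u}^0=\bm{f}$ and the Peaceman-Rachford scheme $$ \bm{u}^{k+1/2}=\bm{u}^{k}+\frac{\tau}{2}\bm{A_1}\bm{u}^{k}+\frac{\tau}{2}\bm{A_2}\bm{u}^{k+1/2}, \qquad \bm{u}^{k+1}=\bm{u}^{k+1/2}+\frac{\tau}{2}\bm{A_1}\bm{u}^{k+1}+\frac{\tau}{2}\bm{A_2}\bm{u}^{k+1/2},\qquad k\ge 0. $$ Then: (i) the scheme preserves the average gray value: $\frac1N\sum_{p=1}^N u^k_p=\frac1N\sum_{p=1}^N f_p$ for every $k\ge 0$; (ii) the scheme preserves positivity: $\bm{u}^k\in\mathbb{R}^N_+$ for every $k\ge 0$; (iii) the sequence $(\bm{u}^k)_{k\ge 0}$ converges, as $k\to\infty$, to a unique steady state.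
   Context: $\mathbb{R}^N_+$ denotes the set of vectors in $\mathbb{R}^N$ with strictly positive entries. Discretised osmosis operator. Let $m,n\ge 1$ be integers with $N:=mn\ge 2$, and let $h>0$ be the grid size. Vectors $\bm{u}\in\mathbb{R}^N$ are identified with grid functions $(u_{i,j})_{1\le i\le m,\,1\le j\le n}$. Let $d_{1,i+\frac12,j}$ ($0\le i\le m$, $1\le j\le n$) and $d_{2,i,j+\frac12}$ ($1\le i\le m$, $0\le j\le n$) be real numbers (values of the two components of a given drift vector field $\bm{d}$ at the cell interfaces). The linear operators $\bm{A_1},\bm{A_2}\in\mathbb{R}^{N\times N}$ are $$(\bm{A_1}\bm{u})_{i,j}=\frac{u_{i+1,j}-2u_{i,j}+u_{i-1,j}}{h^2}-\frac1h\Bigl(d_{1,i+\frac12,j}\frac{u_{i+1,j}+u_{i,j}}{2}-d_{1,i-\frac12,j}\frac{u_{i,j}+u_{i-1,j}}{2}\Bigr),$$ $$(\bm{A_2}\bm{u})_{i,j}=\frac{u_{i,j+1}-2u_{i,j}+u_{i,j-1}}{h^2}-\frac1h\Bigl(d_{2,i,j+\frac12}\frac{u_{i,j+1}+u_{i,j}}{2}-d_{2,i,j-\frac12}\frac{u_{i,j}+u_{i,j-1}}{2}\Bigr),$$ with the zero-flux boundary condition, the discrete form of $\langle\nabla u-\bm{d}u,\bm{n}\rangle=0$ on the boundary of the image domain: $u_{0,j}=u_{1,j}$, $u_{m+1,j}=u_{m,j}$, $u_{i,0}=u_{i,1}$, $u_{i,n+1}=u_{i,n}$ and $d_{1,\frac12,j}=d_{1,m+\frac12,j}=d_{2,i,\frac12}=d_{2,i,n+\frac12}=0$.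 Set $\bm{A}=\bm{A_1}+\bm{A_2}$. Standing assumption on the discretisation: $\bm{A}$ is irreducible and has non-negative off-diagonal entries (it has zero column sums by construction). Steady state. Writing the scheme as $\bm{u}^{k+1}=\bm{P}\bm{u}^k$, a steady state is a vector $\bm{w}$ with $\bm{P}\bm{w}=\bm{w}$; uniqueness is understood for the given average gray value, i.e. $\bm{w}$ is the only vector with $\bm{P}\bm{w}=\bm{w}$ and $\frac1N\sum_p w_p=\frac1N\sum_p f_p$. *)

theory Defs
  imports "HOL-Analysis.Analysis"
begin

text \<open>
  A vector of \<open>\<real>\<^sup>N\<close>, \<open>N = m n\<close>, has type \<open>real ^ 'p\<close>. Its identification with a grid
  function is a bijection \<open>pix\<close> from the index type \<open>'p\<close> onto \<open>{1..m} \<times> {1..n}\<close>, so any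
  numbering of the pixels is allowed.

  \<open>grid_val m n pix u i j\<close> is \<open>u\<^sub>i\<^sub>,\<^sub>j\<close>, also for the ghost indices \<open>i \<in> {0, m + 1}\<close> and
  \<open>j \<in> {0, n + 1}\<close>: clamping the index gives \<open>u\<^sub>0\<^sub>,\<^sub>j = u\<^sub>1\<^sub>,\<^sub>j\<close> and so on, as the zero-flux
  boundary condition prescribes.
\<close>

definition grid_val ::
  "nat \<Rightarrow> nat \<Rightarrow> ('p::finite \<Rightarrow> nat \<times> nat) \<Rightarrow> real ^ 'p \<Rightarrow> nat \<Rightarrow> nat \<Rightarrow> real" where
  "grid_val m n pix u i j = u $ inv pix (max 1 (min m i), max 1 (min n j))"

text \<open>
  Half-integer indices are rounded down: \<open>d1 i j\<close> is the value at \<open>(i + 1/2, j)\<close> and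
  \<open>d2 i j\<close> the value at \<open>(i, j + 1/2)\<close>. The subtractions \<open>i - 1\<close> and \<open>j - 1\<close> never truncate,
  as \<open>pix\<close> takes values with \<open>i \<ge> 1\<close> and \<open>j \<ge> 1\<close>.
\<close>

definition osmosis_op1 ::
  "nat \<Rightarrow> nat \<Rightarrow> ('p::finite \<Rightarrow> nat \<times> nat) \<Rightarrow> real \<Rightarrow> (nat \<Rightarrow> nat \<Rightarrow> real) \<Rightarrow> real ^ 'p \<Rightarrow> real ^ 'p" where
  "osmosis_op1 m n pix h d1 u = (\<chi> p.
     let (i, j) = pix p; U = grid_val m n pix u in
       (U (i + 1) j - 2 * U i j + U (i - 1) j) / h\<^sup>2
       - 1 / h * (d1 i j * ((U (i + 1) j + U i j) / 2)
                  - d1 (i - 1) j * ((U i j + U (i - 1) j) / 2)))"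

definition osmosis_op2 ::
  "nat \<Rightarrow> nat \<Rightarrow> ('p::finite \<Rightarrow> nat \<times> nat) \<Rightarrow> real \<Rightarrow> (nat \<Rightarrow> nat \<Rightarrow> real) \<Rightarrow> real ^ 'p \<Rightarrow> real ^ 'p" where
  "osmosis_op2 m n pix h d2 u = (\<chi> p.
     let (i, j) = pix p; U = grid_val m n pix u in
       (U i (j + 1) - 2 * U i j + U i (j - 1)) / h\<^sup>2
       - 1 / h * (d2 i j * ((U i (j + 1) + U i j) / 2)
                  - d2 i (j - 1) * ((U i j + U i (j - 1)) / 2)))"

lemma linear_osmosis_op1: "linear (osmosis_op1 m n pix h d1)"
  by (rule linearI)
     (simp_all add: osmosis_op1_def grid_val_def vec_eq_iff Let_def split_beta
        add_divide_distrib diff_divide_distrib algebra_simps)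

lemma linear_osmosis_op2: "linear (osmosis_op2 m n pix h d2)"
  by (rule linearI)
     (simp_all add: osmosis_op2_def grid_val_def vec_eq_iff Let_def split_beta
        add_divide_distrib diff_divide_distrib algebra_simps)

text \<open>Strong connectivity of the directed graph of the nonzero entries.\<close>

definition irreducible_mat :: "real ^ 'p ^ 'p \<Rightarrow> bool" where
  "irreducible_mat A \<longleftrightarrow> (\<forall>p q. (p, q) \<in> {(r, s). A $ r $ s \<noteq> 0}\<^sup>*)"

definition average :: "real ^ 'p::finite \<Rightarrow> real" where
  "average u = 1 / real CARD('p) * (\<Sum>p\<in>UNIV. u $ p)"

text \<open>One step from \<open>u\<close> to \<open>u'\<close>, with the intermediate vector \<open>v\<close>.\<close>

definition pr_step ::
  "real \<Rightarrow> real ^ 'p::finite ^ 'p \<Rightarrow> real ^ 'p ^ 'p \<Rightarrow> real ^ 'p \<Rightarrow> real ^ 'p \<Rightarrow> real ^ 'p \<Rightarrow> bool" where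
  "pr_step \<tau> A1 A2 u v u' \<longleftrightarrow>
     v = u + (\<tau> / 2) *\<^sub>R (A1 *v u) + (\<tau> / 2) *\<^sub>R (A2 *v v) \<and>
     u' = v + (\<tau> / 2) *\<^sub>R (A1 *v u') + (\<tau> / 2) *\<^sub>R (A2 *v v)"

text \<open>\<open>u k\<close> is the \<open>k\<close>-th iterate and \<open>v k\<close> the intermediate one with index \<open>k + 1/2\<close>.\<close>

definition peaceman_rachford ::
  "real \<Rightarrow> real ^ 'p::finite ^ 'p \<Rightarrow> real ^ 'p ^ 'p \<Rightarrow> real ^ 'p
    \<Rightarrow> (nat \<Rightarrow> real ^ 'p) \<Rightarrow> (nat \<Rightarrow> real ^ 'p) \<Rightarrow> bool" where
  "peaceman_rachford \<tau> A1 A2 f u v \<longleftrightarrow>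
     u 0 = f \<and> (\<forall>k. pr_step \<tau> A1 A2 (u k) (v k) (u (Suc k)))"

definition pr_matrix :: "real \<Rightarrow> real ^ 'p::finite ^ 'p \<Rightarrow> real ^ 'p ^ 'p \<Rightarrow> real ^ 'p ^ 'p" where
  "pr_matrix \<tau> A1 A2 =
     matrix_inv (mat 1 - (\<tau> / 2) *\<^sub>R A1) ** (mat 1 + (\<tau> / 2) *\<^sub>R A2) **
     matrix_inv (mat 1 - (\<tau> / 2) *\<^sub>R A2) ** (mat 1 + (\<tau> / 2) *\<^sub>R A1)"

lemma matrix_inv_solve_iff:
  fixes M :: "real ^ 'p::finite ^ 'p"
  assumes "invertible M"
  shows "M *v x = b \<longleftrightarrow> x = matrix_inv M *v b"
proof -
  have "M ** matrix_inv M = mat 1" "matrix_inv M ** M = mat 1"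
    using someI_ex[OF assms[unfolded invertible_def]] unfolding matrix_inv_def by blast+
  then show ?thesis
    by (metis matrix_vector_mul_assoc matrix_vector_mul_lid)
qed

lemma pr_step_iff_pr_matrix:
  fixes A1 A2 :: "real ^ 'p::finite ^ 'p"
  assumes "invertible (mat 1 - (\<tau> / 2) *\<^sub>R A1)" "invertible (mat 1 - (\<tau> / 2) *\<^sub>R A2)"
  shows "(\<exists>v. pr_step \<tau> A1 A2 u v u') \<longleftrightarrow> u' = pr_matrix \<tau> A1 A2 *v u"
proof -
  have "pr_step \<tau> A1 A2 u v u' \<longleftrightarrow>
      (mat 1 - (\<tau> / 2) *\<^sub>R A2) *v v = (mat 1 + (\<tau> / 2) *\<^sub>R A1) *v u \<and>
      (mat 1 - (\<tau> / 2) *\<^sub>R A1) *v u' = (mat 1 + (\<tau> / 2) *\<^sub>R A2) *v v" for v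
    unfolding pr_step_def
    by (simp add: matrix_vector_mult_diff_rdistrib matrix_vector_mult_add_rdistrib
        scaleR_matrix_vector_assoc[symmetric] diff_eq_eq add_ac)
  then show ?thesis
    unfolding matrix_inv_solve_iff[OF assms(1)] matrix_inv_solve_iff[OF assms(2)]
    by (simp add: pr_matrix_def matrix_vector_mul_assoc[symmetric])
qed

definition steady_state :: "real ^ 'p::finite ^ 'p \<Rightarrow> real ^ 'p \<Rightarrow> bool" where
  "steady_state P w \<longleftrightarrow> P *v w = w"

end

theory Submission
  imports Defs
begin

text \<open>
  The scheme is a Markov chain in disguise. The operators \<open>A\<^sub>1\<close> and \<open>A\<^sub>2\<close> couple different
  pairs of pixels: \<open>A\<^sub>1\<close> only pixels with the same second index, \<open>A\<^sub>2\<close> only pixels with the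
  same first index. Hence an off-diagonal entry of \<open>A\<close> comes from just one of them, and each
  inherits non-negative off-diagonal entries. Each is moreover a difference of fluxes that
  vanish on the boundary, so its columns sum to zero. Both are therefore generators of
  continuous-time Markov chains, acting on column vectors (\<open>osmosis_generators\<close>).

  Consequently all four factors of
  \<open>P = (I - \<tau>/2 A\<^sub>1)\<^sup>-\<^sup>1 (I + \<tau>/2 A\<^sub>2) (I - \<tau>/2 A\<^sub>2)\<^sup>-\<^sup>1 (I + \<tau>/2 A\<^sub>1)\<close>
  are column-stochastic with positive diagonal: the resolvents for every \<open>\<tau> \<ge> 0\<close>, by a
  maximum principle (\<open>resolvent_nonneg\<close>), and the explicit factors because the step-size
  restriction says exactly that their diagonals stay positive. So \<open>P\<close> preserves the sum of the
  entries and positivity, which gives (i) and (ii).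

  For (iii), positive diagonals ensure that no entry is lost when the factors are
  multiplied: \<open>P\<close> is positive on the diagonal and wherever \<open>A\<^sub>1\<close> or \<open>A\<^sub>2\<close> is nonzero.
  Irreducibility of \<open>A\<close> then makes some power of \<open>P\<close> positive in all entries. Such a power is a
  strict contraction of the 1-norm on vectors with entry sum zero
  (\<open>column_stochastic_contraction\<close>, the argument of Doeblin), so the iterates of two vectors
  with equal average approach each other. A fixed vector exists since \<open>I - P\<close> maps into the
  vectors of sum zero and is thus singular; comparing the iterates with the multiple of it
  that has the right average gives convergence and uniqueness (\<open>column_stochastic_powers_tendsto\<close>).
\<close>

section \<open>Column-stochastic matrices\<close>

definition column_stochastic :: "real ^ 'p::finite ^ 'p \<Rightarrow> bool" where
  "column_stochastic M \<longleftrightarrow> (\<forall>p q. 0 \<le> M $ p $ q) \<and> (\<forall>q. (\<Sum>p\<in>UNIV. M $ p $ q) = 1)"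

text \<open>
  Tracking the positive entries of a matrix by a relation turns matrix products into
  relational composition, and thereby irreducibility into a statement about powers of a relation.
\<close>

definition positive_on :: "('p \<times> 'p) set \<Rightarrow> real ^ 'p ^ 'p \<Rightarrow> bool" where
  "positive_on R M \<longleftrightarrow> (\<forall>p q. (p, q) \<in> R \<longrightarrow> 0 < M $ p $ q)"

primrec mat_power :: "real ^ 'p::finite ^ 'p \<Rightarrow> nat \<Rightarrow> real ^ 'p ^ 'p" where
  "mat_power M 0 = mat 1"
| "mat_power M (Suc k) = M ** mat_power M k"

lemma mat_power_add: "mat_power M (j + k) = mat_power M j ** mat_power M k"
  by (induction j) (simp_all add: matrix_mul_assoc)

lemma mat_power_fixed: "P *v w = w \<Longrightarrow> mat_power P k *v w = w"
  by (induction k) (simp_all add: matrix_vector_mul_assoc[symmetric])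

lemma sum_matrix_vector_mult:
  fixes M :: "real ^ 'p::finite ^ 'p"
  shows "(\<Sum>p\<in>UNIV. (M *v x) $ p) = (\<Sum>q\<in>UNIV. (\<Sum>p\<in>UNIV. M $ p $ q) * x $ q)"
  unfolding matrix_vector_mult_def by (simp add: sum_distrib_right) (rule sum.swap)

lemma column_stochastic_sum:
  assumes "column_stochastic M"
  shows "(\<Sum>p\<in>UNIV. (M *v x) $ p) = (\<Sum>p\<in>UNIV. x $ p)"
  using assms by (simp add: sum_matrix_vector_mult column_stochastic_def)

lemma matrix_entry_mult_axis:
  fixes M :: "real ^ 'p::finite ^ 'p"
  shows "M $ p $ q = (M *v axis q 1) $ p"
  by (simp add: matrix_vector_mult_basis column_def)

lemma matrix_mult_axis:
  fixes X M :: "real ^ 'p::finite ^ 'p"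
  shows "(X ** M) $ p $ q = (X *v (M *v axis q 1)) $ p"
  by (simp add: matrix_entry_mult_axis[of "X ** M"] matrix_vector_mul_assoc)

lemma column_stochastic_mat_1: "column_stochastic (mat 1)"
  by (simp add: column_stochastic_def mat_def)

lemma column_stochastic_mult:
  assumes "column_stochastic X" "column_stochastic Y"
  shows "column_stochastic (X ** Y)"
proof -
  have "0 \<le> (X ** Y) $ p $ q" for p q
    using assms unfolding column_stochastic_def matrix_matrix_mult_def
    by (simp add: sum_nonneg)
  moreover have "(\<Sum>p\<in>UNIV. (X ** Y) $ p $ q) = 1" for q
  proof -
    have "(\<Sum>p\<in>UNIV. (X ** Y) $ p $ q) = (\<Sum>p\<in>UNIV. (Y *v axis q 1) $ p)"
      by (simp only: matrix_mult_axis column_stochastic_sum[OF assms(1)])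
    then show ?thesis
      using assms(2) by (simp add: matrix_entry_mult_axis[symmetric] column_stochastic_def)
  qed
  ultimately show ?thesis by (simp add: column_stochastic_def)
qed

lemma column_stochastic_mat_power:
  "column_stochastic M \<Longrightarrow> column_stochastic (mat_power M k)"
  by (induction k) (simp_all add: column_stochastic_mat_1 column_stochastic_mult)

lemma positive_on_mult:
  assumes "column_stochastic X" "column_stochastic Y" "positive_on R X" "positive_on S Y"
  shows "positive_on (R O S) (X ** Y)"
  unfolding positive_on_def
proof (intro allI impI)
  fix p q assume "(p, q) \<in> R O S"
  then obtain r where r: "(p, r) \<in> R" "(r, q) \<in> S" by blast
  have "0 < X $ p $ r * Y $ r $ q"
    using r assms(3,4) by (simp add: positive_on_def)
  also have "\<dots> \<le> (\<Sum>s\<in>UNIV. X $ p $ s * Y $ s $ q)"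
    using assms(1,2) by (intro member_le_sum) (auto simp: column_stochastic_def)
  finally show "0 < (X ** Y) $ p $ q" by (simp add: matrix_matrix_mult_def)
qed

lemma positive_on_mat_power:
  assumes "column_stochastic M" "positive_on R M"
  shows "positive_on (R ^^ k) (mat_power M k)"
proof (induction k)
  case 0
  show ?case by (simp add: positive_on_def mat_def)
next
  case (Suc k)
  show ?case
    using positive_on_mult[OF assms(1) column_stochastic_mat_power[OF assms(1)] assms(2) Suc]
    by (simp add: relpow_commute)
qed

lemma positive_on_mono: "positive_on S M \<Longrightarrow> R \<subseteq> S \<Longrightarrow> positive_on R M"
  by (auto simp: positive_on_def)

lemma column_stochastic_preserves_positive:
  assumes "column_stochastic M" "positive_on Id M" "\<forall>p. 0 < x $ p"
  shows "0 < (M *v x) $ p"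
proof -
  have "0 < M $ p $ p * x $ p"
    using assms(2,3) by (simp add: positive_on_def)
  also have "\<dots> \<le> (\<Sum>q\<in>UNIV. M $ p $ q * x $ q)"
    using assms(1,3)
    by (intro member_le_sum) (auto simp: column_stochastic_def intro: mult_nonneg_nonneg less_imp_le)
  finally show ?thesis by (simp add: matrix_vector_mult_def)
qed

text \<open>
  On a finite type every path can be shortened to a bounded length, and loops allow
  padding all paths to one common length. The loops are what excludes periodicity.
\<close>

lemma reflexive_rtrancl_UNIV_relpow:
  fixes R :: "('p::finite \<times> 'p) set"
  assumes "Id \<subseteq> R" "R\<^sup>* = UNIV"
  obtains K where "R ^^ K = UNIV"
proof
  have step: "R ^^ k \<subseteq> R ^^ Suc k" for k
    using assms(1) by auto
  have "R ^^ k \<subseteq> R ^^ card R" if "k \<le> card R" for k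
    using lift_Suc_mono_le[of "\<lambda>k. R ^^ k", OF step that] .
  moreover have "R\<^sup>* = (\<Union>k\<in>{k. k \<le> card R}. R ^^ k)"
    by (rule rtrancl_finite_eq_relpow) simp
  ultimately show "R ^^ card R = UNIV"
    using assms(2) by blast
qed

section \<open>Convergence of powers\<close>

text \<open>
  On vectors of sum zero the constant matrix with entries \<open>\<delta>\<close> acts as zero, so it may be
  subtracted from \<open>M\<close> without changing the image; the remainder is non-negative with column
  sums \<open>1 - N \<delta>\<close>. The case \<open>\<delta> = 0\<close> gives monotonicity of the 1-norm.
\<close>

lemma column_stochastic_contraction:
  fixes M :: "real ^ 'p::finite ^ 'p"
  assumes M: "column_stochastic M" and ge: "\<And>p q. \<delta> \<le> M $ p $ q"
    and zero: "(\<Sum>p\<in>UNIV. x $ p) = 0"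
  shows "(\<Sum>p\<in>UNIV. \<bar>(M *v x) $ p\<bar>) \<le> (1 - real CARD('p) * \<delta>) * (\<Sum>p\<in>UNIV. \<bar>x $ p\<bar>)"
proof -
  have "\<bar>(M *v x) $ p\<bar> \<le> (\<Sum>q\<in>UNIV. (M $ p $ q - \<delta>) * \<bar>x $ q\<bar>)" for p
  proof -
    have "(M *v x) $ p = (\<Sum>q\<in>UNIV. M $ p $ q * x $ q) - \<delta> * (\<Sum>q\<in>UNIV. x $ q)"
      by (simp add: matrix_vector_mult_def zero)
    also have "\<dots> = (\<Sum>q\<in>UNIV. (M $ p $ q - \<delta>) * x $ q)"
      by (simp add: sum_distrib_left sum_subtractf left_diff_distrib)
    finally have "\<bar>(M *v x) $ p\<bar> = \<bar>\<Sum>q\<in>UNIV. (M $ p $ q - \<delta>) * x $ q\<bar>" by simp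
    also have "\<dots> \<le> (\<Sum>q\<in>UNIV. \<bar>(M $ p $ q - \<delta>) * x $ q\<bar>)" by (rule sum_abs)
    finally show ?thesis using ge by (simp add: abs_mult)
  qed
  then have "(\<Sum>p\<in>UNIV. \<bar>(M *v x) $ p\<bar>)
      \<le> (\<Sum>p\<in>UNIV. \<Sum>q\<in>UNIV. (M $ p $ q - \<delta>) * \<bar>x $ q\<bar>)"
    by (intro sum_mono)
  also have "\<dots> = (\<Sum>q\<in>UNIV. \<Sum>p\<in>UNIV. (M $ p $ q - \<delta>) * \<bar>x $ q\<bar>)"
    by (rule sum.swap)
  also have "\<dots> = (\<Sum>q\<in>UNIV. (1 - real CARD('p) * \<delta>) * \<bar>x $ q\<bar>)"
    using M by (simp add: sum_distrib_right[symmetric] sum_subtractf column_stochastic_def)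
  finally show ?thesis by (simp add: sum_distrib_left)
qed

text \<open>
  The 1-norms of the iterates never increase and shrink by a factor \<open>\<rho> < 1\<close> in
  every \<open>K\<close> steps, so their limit \<open>l\<close> satisfies \<open>l \<le> \<rho> l\<close>.
\<close>

lemma mat_power_zero_sum_tendsto_0:
  fixes P :: "real ^ 'p::finite ^ 'p"
  assumes P: "column_stochastic P" and pos: "positive_on R P"
    and R: "Id \<subseteq> R" "R\<^sup>* = UNIV" and zero: "(\<Sum>p\<in>UNIV. x $ p) = 0"
  shows "(\<lambda>k. mat_power P k *v x) \<longlonglongrightarrow> 0"
proof -
  obtain K where K: "R ^^ K = UNIV"
    using reflexive_rtrancl_UNIV_relpow[OF R] .
  have posK: "0 < mat_power P K $ p $ q" for p q
    using positive_on_mat_power[OF P pos, of K] by (simp add: positive_on_def K)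
  define \<delta> where "\<delta> = Min (range (\<lambda>(p, q). mat_power P K $ p $ q))"
  have \<delta>_le: "\<delta> \<le> mat_power P K $ p $ q" for p q
    unfolding \<delta>_def by (rule Min_le) (auto intro: image_eqI[of _ _ "(p, q)"])
  have \<delta>_pos: "0 < \<delta>"
    unfolding \<delta>_def by (subst Min_gr_iff) (auto simp: posK)
  define \<rho> where "\<rho> = 1 - real CARD('p) * \<delta>"
  define a where "a k = (\<Sum>p\<in>UNIV. \<bar>(mat_power P k *v x) $ p\<bar>)" for k
  have zero_k: "(\<Sum>p\<in>UNIV. (mat_power P k *v x) $ p) = 0" for k
    using column_stochastic_sum[OF column_stochastic_mat_power[OF P]] zero by simp
  have dec: "decseq a"
  proof (rule decseq_SucI)
    fix k
    show "a (Suc k) \<le> a k"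
      using column_stochastic_contraction[OF P _ zero_k[of k], of 0] P
      by (simp add: a_def matrix_vector_mul_assoc column_stochastic_def)
  qed
  have jump: "a (K + k) \<le> \<rho> * a k" for k
    using column_stochastic_contraction[OF column_stochastic_mat_power[OF P] \<delta>_le zero_k[of k]]
    by (simp add: a_def \<rho>_def matrix_vector_mul_assoc mat_power_add)
  have a_nonneg: "0 \<le> a k" for k by (simp add: a_def sum_nonneg)
  obtain l where l: "a \<longlonglongrightarrow> l"
    using decseq_convergent[OF dec, of 0] a_nonneg by blast
  have "(\<lambda>k. a (k + K)) \<longlonglongrightarrow> l" using LIMSEQ_ignore_initial_segment[OF l] .
  moreover have "(\<lambda>k. \<rho> * a k) \<longlonglongrightarrow> \<rho> * l" using l by (intro tendsto_intros)
  ultimately have "l \<le> \<rho> * l"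
    by (rule LIMSEQ_le) (use jump in \<open>auto simp: add.commute\<close>)
  moreover have "0 \<le> l" using LIMSEQ_le_const[OF l] a_nonneg by blast
  ultimately have "l = 0"
    using \<delta>_pos by (simp add: \<rho>_def left_diff_distrib mult_le_0_iff zero_less_mult_iff)
  have "(\<lambda>k. (mat_power P k *v x) $ p) \<longlonglongrightarrow> 0" for p
  proof (rule tendsto_rabs_zero_cancel, rule tendsto_sandwich[OF _ _ tendsto_const])
    show "\<forall>\<^sub>F k in sequentially. 0 \<le> \<bar>(mat_power P k *v x) $ p\<bar>" by simp
    show "\<forall>\<^sub>F k in sequentially. \<bar>(mat_power P k *v x) $ p\<bar> \<le> a k"
      unfolding a_def by (intro always_eventually allI member_le_sum) auto
    show "a \<longlonglongrightarrow> 0" using l \<open>l = 0\<close> by simp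
  qed
  then show ?thesis by (intro vec_tendstoI) simp
qed

text \<open>
  Conservation of the sum keeps the range of \<open>I - P\<close> inside a proper subspace, so \<open>I - P\<close>
  has a nontrivial kernel.
\<close>

lemma column_stochastic_has_fixed_vector:
  fixes P :: "real ^ 'p::finite ^ 'p"
  assumes "column_stochastic P"
  obtains w where "w \<noteq> 0" "P *v w = w"
proof -
  define g where "g = (\<lambda>x. x - P *v x)"
  have lin: "linear g"
    unfolding g_def by (intro linear_compose_sub linear_ident matrix_vector_mul_linear)
  have "(\<Sum>p\<in>UNIV. g x $ p) = 0" for x
    using column_stochastic_sum[OF assms] by (simp add: g_def sum_subtractf)
  moreover have "(\<Sum>p\<in>UNIV. (axis q 1 :: real ^ 'p) $ p) = 1" for q
    by (simp add: axis_def)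
  ultimately have "\<not> surj g"
    by (metis surjD zero_neq_one)
  then have "\<not> inj g"
    using linear_injective_imp_surjective[OF lin] by blast
  then obtain w where "g w = 0" "w \<noteq> 0"
    using linear_injective_0[OF lin] by blast
  then show ?thesis using that by (simp add: g_def)
qed

text \<open>
  A nonzero fixed vector cannot have sum zero, because its constant sequence of iterates
  would tend to zero. It can therefore be rescaled to any prescribed sum \<open>s\<close>.
\<close>

lemma column_stochastic_powers_tendsto:
  fixes P :: "real ^ 'p::finite ^ 'p"
  assumes P: "column_stochastic P" and pos: "positive_on R P"
    and R: "Id \<subseteq> R" "R\<^sup>* = UNIV"
  obtains w where "P *v w = w" "(\<Sum>p\<in>UNIV. w $ p) = s"
    "\<And>x. (\<Sum>p\<in>UNIV. x $ p) = s \<Longrightarrow> (\<lambda>k. mat_power P k *v x) \<longlonglongrightarrow> w"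
proof -
  note lim0 = mat_power_zero_sum_tendsto_0[OF P pos R]
  obtain w where w: "w \<noteq> 0" "P *v w = w"
    using column_stochastic_has_fixed_vector[OF P] .
  define c where "c = (\<Sum>p\<in>UNIV. w $ p)"
  have "c \<noteq> 0"
    using lim0[of w] w by (auto simp: c_def mat_power_fixed LIMSEQ_const_iff)
  define z where "z = (s / c) *\<^sub>R w"
  have z: "P *v z = z" "(\<Sum>p\<in>UNIV. z $ p) = s"
  proof -
    show "P *v z = z" by (simp add: z_def matrix_vector_mult_scaleR w(2))
    have "(\<Sum>p\<in>UNIV. z $ p) = s / c * c"
      by (simp only: z_def vector_scaleR_component real_scaleR_def sum_distrib_left[symmetric] c_def[symmetric])
    then show "(\<Sum>p\<in>UNIV. z $ p) = s" using \<open>c \<noteq> 0\<close> by simp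
  qed
  moreover have "(\<lambda>k. mat_power P k *v x) \<longlonglongrightarrow> z" if "(\<Sum>p\<in>UNIV. x $ p) = s" for x
  proof -
    have "(\<lambda>k. mat_power P k *v (x - z)) \<longlonglongrightarrow> 0"
      by (rule lim0) (simp add: sum_subtractf that z(2))
    then show ?thesis
      by (simp add: matrix_vector_mult_diff_distrib mat_power_fixed[OF z(1)] LIM_zero_iff)
  qed
  ultimately show ?thesis by (rule that)
qed

section \<open>Markov generators and their resolvents\<close>

definition markov_generator :: "real ^ 'p::finite ^ 'p \<Rightarrow> bool" where
  "markov_generator B \<longleftrightarrow>
     (\<forall>p q. p \<noteq> q \<longrightarrow> 0 \<le> B $ p $ q) \<and> (\<forall>q. (\<Sum>p\<in>UNIV. B $ p $ q) = 0)"

lemma markov_generator_diag_nonpos: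
  assumes "markov_generator B"
  shows "B $ p $ p \<le> 0"
proof -
  have "(\<Sum>q\<in>UNIV. B $ q $ p) = B $ p $ p + (\<Sum>q\<in>UNIV - {p}. B $ q $ p)"
    by (simp add: sum.remove)
  moreover have "0 \<le> (\<Sum>q\<in>UNIV - {p}. B $ q $ p)"
    using assms by (intro sum_nonneg) (auto simp: markov_generator_def)
  ultimately show ?thesis using assms by (simp add: markov_generator_def)
qed

text \<open>
  The part of column \<open>q\<close> outside \<open>S\<close> is off-diagonal, hence non-negative, and the whole
  column sums to zero.
\<close>

lemma markov_generator_subset_sum_nonpos:
  assumes "markov_generator B" "q \<in> S"
  shows "(\<Sum>p\<in>S. B $ p $ q) \<le> 0"
proof -
  have "(\<Sum>p\<in>UNIV. B $ p $ q) = (\<Sum>p\<in>S. B $ p $ q) + (\<Sum>p\<in>- S. B $ p $ q)"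
    using sum.subset_diff[of S UNIV "\<lambda>p. B $ p $ q"] by (simp add: Compl_eq_Diff_UNIV add.commute)
  moreover have "0 \<le> (\<Sum>p\<in>- S. B $ p $ q)"
    using assms by (intro sum_nonneg) (force simp: markov_generator_def)
  ultimately show ?thesis using assms by (simp add: markov_generator_def)
qed

text \<open>
  Off the diagonal non-negativity is that of \<open>B\<close>; the bound on the step size \<open>t\<close> is what
  keeps the diagonal entries \<open>1 - t \<bar>B\<^sub>p\<^sub>p\<bar>\<close> positive.
\<close>

lemma column_stochastic_explicit_step:
  assumes B: "markov_generator B" and t: "0 < t" and small: "\<And>p. t * \<bar>B $ p $ p\<bar> < 1"
  shows "column_stochastic (mat 1 + t *\<^sub>R B)"
    and "positive_on (Id \<union> {(p, q). B $ p $ q \<noteq> 0}) (mat 1 + t *\<^sub>R B)"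
proof -
  have diag: "0 < (mat 1 + t *\<^sub>R B) $ p $ p" for p
    using small[of p] markov_generator_diag_nonpos[OF B, of p] by (simp add: mat_def)
  have off: "(mat 1 + t *\<^sub>R B) $ p $ q = t * B $ p $ q" "0 \<le> B $ p $ q" if "p \<noteq> q" for p q
    using that B by (simp_all add: mat_def markov_generator_def)
  have "0 \<le> (mat 1 + t *\<^sub>R B) $ p $ q" for p q
    using diag[of p] off[of p q] t by (cases "p = q") auto
  moreover have "(\<Sum>p\<in>UNIV. (mat 1 + t *\<^sub>R B) $ p $ q) = 1" for q
    using B by (simp add: sum.distrib mat_def sum_distrib_left[symmetric] markov_generator_def)
  ultimately show "column_stochastic (mat 1 + t *\<^sub>R B)"
    by (simp add: column_stochastic_def)
  have "0 < (mat 1 + t *\<^sub>R B) $ p $ q" if "B $ p $ q \<noteq> 0 \<or> p = q" for p q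
    using diag[of p] off[of p q] t that by (cases "p = q") auto
  then show "positive_on (Id \<union> {(p, q). B $ p $ q \<noteq> 0}) (mat 1 + t *\<^sub>R B)"
    by (auto simp: positive_on_def)
qed

text \<open>
  A maximum principle for sums: adding up the equations over the set \<open>S\<close> where \<open>x\<close> is
  negative, the columns in \<open>S\<close> contribute at most their value of \<open>x\<close>, since mass can only leave
  \<open>S\<close>, and the others contribute nothing positive. So the right-hand side would have a
  negative sum over \<open>S\<close> if \<open>S\<close> were nonempty.
\<close>

lemma resolvent_nonneg:
  fixes B :: "real ^ 'p::finite ^ 'p"
  assumes B: "markov_generator B" and t: "0 \<le> t"
    and nonneg: "\<And>p. 0 \<le> ((mat 1 - t *\<^sub>R B) *v x) $ p"
  shows "0 \<le> x $ p"
proof (rule ccontr)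
  define M where "M = mat 1 - t *\<^sub>R B"
  define S where "S = {p. x $ p < 0}"
  assume "\<not> 0 \<le> x $ p"
  then have "p \<in> S" by (simp add: S_def)
  have col: "(\<Sum>p\<in>S. M $ p $ q) * x $ q \<le> (if q \<in> S then x $ q else 0)" for q
  proof (cases "q \<in> S")
    case True
    have "(\<Sum>p\<in>S. M $ p $ q) = 1 - t * (\<Sum>p\<in>S. B $ p $ q)"
      using True by (simp add: M_def mat_def sum_subtractf sum_distrib_left)
    also have "\<dots> \<ge> 1"
      using mult_nonneg_nonpos[OF t markov_generator_subset_sum_nonpos[OF B True]] by simp
    finally show ?thesis
      using True mult_right_mono_neg[of 1 "\<Sum>p\<in>S. M $ p $ q" "x $ q"] by (simp add: S_def)
  next
    case False
    then have "M $ p $ q \<le> 0" if "p \<in> S" for p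
      using that B t by (auto simp: M_def mat_def markov_generator_def)
    then have "(\<Sum>p\<in>S. M $ p $ q) \<le> 0" by (rule sum_nonpos)
    then show ?thesis
      using False by (simp add: S_def mult_nonpos_nonneg)
  qed
  have "0 \<le> (\<Sum>p\<in>S. (M *v x) $ p)"
    using nonneg by (intro sum_nonneg) (simp add: M_def)
  also have "\<dots> = (\<Sum>p\<in>S. \<Sum>q\<in>UNIV. M $ p $ q * x $ q)"
    by (simp add: matrix_vector_mult_def)
  also have "\<dots> = (\<Sum>q\<in>UNIV. (\<Sum>p\<in>S. M $ p $ q) * x $ q)"
    by (subst sum.swap) (simp add: sum_distrib_right)
  also have "\<dots> \<le> (\<Sum>q\<in>UNIV. if q \<in> S then x $ q else 0)"
    by (intro sum_mono col)
  also have "\<dots> = (\<Sum>q\<in>S. x $ q)"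
    by (simp add: sum.If_cases)
  also have "\<dots> < (\<Sum>q\<in>S. 0)"
    using \<open>p \<in> S\<close> by (intro sum_strict_mono) (auto simp: S_def)
  finally show False by simp
qed

lemma resolvent_invertible:
  fixes B :: "real ^ 'p::finite ^ 'p"
  assumes B: "markov_generator B" and t: "0 \<le> t"
  shows "invertible (mat 1 - t *\<^sub>R B)"
proof -
  have "x = 0" if x: "(mat 1 - t *\<^sub>R B) *v x = 0" for x
  proof -
    have "0 \<le> x $ p" for p
      by (rule resolvent_nonneg[OF B t]) (simp add: x)
    moreover have "0 \<le> (- x) $ p" for p
    proof (rule resolvent_nonneg[OF B t])
      have "(mat 1 - t *\<^sub>R B) *v (- x) = 0"
        using matrix_vector_mult_diff_distrib[of "mat 1 - t *\<^sub>R B" 0 x] by (simp add: x)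
      then show "0 \<le> ((mat 1 - t *\<^sub>R B) *v (- x)) $ p" for p by simp
    qed
    ultimately have "x $ p = 0" for p
      by (metis antisym neg_0_le_iff_le vector_uminus_component)
    then show "x = 0" by (simp add: vec_eq_iff)
  qed
  then show ?thesis
    unfolding invertible_left_inverse matrix_left_invertible_ker by blast
qed

text \<open>
  The columns \<open>e q\<close> of the inverse solve \<open>M e = axis q 1\<close>. They are non-negative by the
  maximum principle and have sum one because \<open>M\<close> has column sums one. If \<open>e p\<close>
  vanished at \<open>p\<close>, only the non-positive off-diagonal entries of \<open>M\<close> would contribute to the
  \<open>p\<close>-th equation, whose right-hand side is \<open>1\<close>.
\<close>

lemma column_stochastic_resolvent:
  fixes B :: "real ^ 'p::finite ^ 'p"
  assumes B: "markov_generator B" and t: "0 \<le> t"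
  shows "column_stochastic (matrix_inv (mat 1 - t *\<^sub>R B))"
    and "positive_on Id (matrix_inv (mat 1 - t *\<^sub>R B))"
proof -
  define M where "M = mat 1 - t *\<^sub>R B"
  define e where "e q = matrix_inv M *v axis q 1" for q
  have Me: "M *v e q = axis q 1" for q
    using matrix_inv_solve_iff[OF resolvent_invertible[OF B t]] by (simp add: M_def e_def)
  have entry: "matrix_inv M $ p $ q = e q $ p" for p q
    by (simp add: e_def matrix_entry_mult_axis)
  have nonneg: "0 \<le> e q $ p" for p q
    by (rule resolvent_nonneg[OF B t]) (simp add: M_def[symmetric] Me axis_def)
  have "(\<Sum>p\<in>UNIV. e q $ p) = 1" for q
  proof -
    have "(\<Sum>p\<in>UNIV. M $ p $ r) = 1" for r
      using B by (simp add: M_def sum_subtractf mat_def sum_distrib_left[symmetric] markov_generator_def)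
    then have "(\<Sum>p\<in>UNIV. e q $ p) = (\<Sum>p\<in>UNIV. (M *v e q) $ p)"
      by (simp add: sum_matrix_vector_mult)
    then show ?thesis by (simp add: Me axis_def)
  qed
  with nonneg have "column_stochastic (matrix_inv M)"
    by (simp add: column_stochastic_def entry)
  then show "column_stochastic (matrix_inv (mat 1 - t *\<^sub>R B))" by (simp add: M_def)
  have "e p $ p \<noteq> 0" for p
  proof
    assume zero: "e p $ p = 0"
    have "1 = (M *v e p) $ p" by (simp add: Me axis_def)
    also have "\<dots> = (\<Sum>q\<in>UNIV. M $ p $ q * e p $ q)" by (simp add: matrix_vector_mult_def)
    also have "\<dots> \<le> 0"
    proof (rule sum_nonpos)
      fix q
      show "M $ p $ q * e p $ q \<le> 0"
        using zero nonneg[of p q] B t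
        by (cases "q = p") (auto simp: M_def mat_def markov_generator_def intro!: mult_nonneg_nonneg)
    qed
    finally show False by simp
  qed
  then have "positive_on Id (matrix_inv M)"
    using nonneg by (auto simp: positive_on_def entry less_le)
  then show "positive_on Id (matrix_inv (mat 1 - t *\<^sub>R B))" by (simp add: M_def)
qed

section \<open>The Peaceman-Rachford matrix\<close>

text \<open>
  In the product of the four supports, the diagonals of three factors let the edges of the
  fourth pass through, so the edges of both \<open>A1\<close> and \<open>A2\<close> survive.
\<close>

lemma pr_matrix_stochastic:
  fixes A1 A2 :: "real ^ 'p::finite ^ 'p"
  assumes gen: "markov_generator A1" "markov_generator A2" and \<tau>: "0 < \<tau>"
    and small: "\<And>p. \<tau> / 2 * \<bar>A1 $ p $ p\<bar> < 1" "\<And>p. \<tau> / 2 * \<bar>A2 $ p $ p\<bar> < 1"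
  shows "column_stochastic (pr_matrix \<tau> A1 A2)"
    and "positive_on (Id \<union> {(p, q). A1 $ p $ q \<noteq> 0 \<or> A2 $ p $ q \<noteq> 0}) (pr_matrix \<tau> A1 A2)"
proof -
  have t: "0 < \<tau> / 2" "0 \<le> \<tau> / 2" using \<tau> by auto
  note res1 = column_stochastic_resolvent[OF gen(1) t(2)]
    and res2 = column_stochastic_resolvent[OF gen(2) t(2)]
    and exp1 = column_stochastic_explicit_step[OF gen(1) t(1) small(1)]
    and exp2 = column_stochastic_explicit_step[OF gen(2) t(1) small(2)]
  note prod2 = column_stochastic_mult[OF res1(1) exp2(1)]
  note prod3 = column_stochastic_mult[OF prod2 res2(1)]
  show "column_stochastic (pr_matrix \<tau> A1 A2)"
    unfolding pr_matrix_def by (rule column_stochastic_mult[OF prod3 exp1(1)])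
  have "positive_on (((Id O (Id \<union> {(p, q). A2 $ p $ q \<noteq> 0})) O Id) O (Id \<union> {(p, q). A1 $ p $ q \<noteq> 0}))
      (pr_matrix \<tau> A1 A2)"
    unfolding pr_matrix_def
    by (intro positive_on_mult prod3 prod2 res1 res2 exp1 exp2)
  then show "positive_on (Id \<union> {(p, q). A1 $ p $ q \<noteq> 0 \<or> A2 $ p $ q \<noteq> 0}) (pr_matrix \<tau> A1 A2)"
    by (rule positive_on_mono) auto
qed

text \<open>
  Both implicit half steps are uniquely solvable, so a run of the scheme is the orbit of \<open>f\<close>
  under the matrix \<open>P\<close> of one full step, together with the intermediate vectors that it determines.
\<close>

lemma peaceman_rachford_iff:
  fixes A1 A2 :: "real ^ 'p::finite ^ 'p"
  assumes "invertible (mat 1 - (\<tau> / 2) *\<^sub>R A1)" "invertible (mat 1 - (\<tau> / 2) *\<^sub>R A2)"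
  shows "peaceman_rachford \<tau> A1 A2 f u v \<longleftrightarrow>
    u = (\<lambda>k. mat_power (pr_matrix \<tau> A1 A2) k *v f) \<and>
    v = (\<lambda>k. matrix_inv (mat 1 - (\<tau> / 2) *\<^sub>R A2) *v ((mat 1 + (\<tau> / 2) *\<^sub>R A1) *v u k))"
    (is "_ \<longleftrightarrow> u = ?U \<and> v = ?V u")
proof -
  have step: "pr_step \<tau> A1 A2 a b c \<longleftrightarrow>
      b = matrix_inv (mat 1 - (\<tau> / 2) *\<^sub>R A2) *v ((mat 1 + (\<tau> / 2) *\<^sub>R A1) *v a) \<and>
      c = pr_matrix \<tau> A1 A2 *v a" for a b c
  proof -
    have v_eq: "pr_step \<tau> A1 A2 a b c \<Longrightarrow>
        b = matrix_inv (mat 1 - (\<tau> / 2) *\<^sub>R A2) *v ((mat 1 + (\<tau> / 2) *\<^sub>R A1) *v a)" for b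
      unfolding pr_step_def matrix_inv_solve_iff[OF assms(2), symmetric]
      by (simp add: matrix_vector_mult_diff_rdistrib matrix_vector_mult_add_rdistrib
          scaleR_matrix_vector_assoc[symmetric] diff_eq_eq)
    then show ?thesis
      using pr_step_iff_pr_matrix[OF assms, of a c] by metis
  qed
  have "u = ?U" if "u 0 = f" "\<And>k. u (Suc k) = pr_matrix \<tau> A1 A2 *v u k"
  proof
    show "u k = ?U k" for k
      by (induction k) (simp_all add: that matrix_vector_mul_assoc)
  qed
  then show ?thesis
    unfolding peaceman_rachford_def step by (auto simp: matrix_vector_mul_assoc)
qed

section \<open>The osmosis operators\<close>

text \<open>
  Exchanging the two grid axes turns one operator into the other, so every fact on \<open>A1\<close>
  transfers to \<open>A2\<close>.
\<close>

lemma osmosis_op2_eq_op1_swap: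
  "osmosis_op2 m n pix h d2 = osmosis_op1 n m (prod.swap \<circ> pix) h (\<lambda>j i. d2 i j)"
proof -
  have swap: "prod.swap x = y \<longleftrightarrow> x = prod.swap y" for x y :: "nat \<times> nat" by auto
  have "inv (prod.swap \<circ> pix) (a, b) = inv pix (b, a)" for a b
    by (simp add: inv_into_def swap)
  then have "grid_val n m (prod.swap \<circ> pix) u j i = grid_val m n pix u i j" for u i j
    by (simp add: grid_val_def)
  then show ?thesis
    by (simp add: fun_eq_iff osmosis_op1_def osmosis_op2_def vec_eq_iff split_beta Let_def)
qed

text \<open>
  The operator is the difference of the fluxes \<open>F\<close> through the two interfaces of a pixel. Along
  a grid line the differences telescope to the boundary fluxes, which vanish.
\<close>

lemma osmosis_op1_sum_eq_0:
  assumes pix: "bij_betw pix UNIV ({1..m} \<times> {1..n})"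
    and bd: "\<forall>j\<in>{1..n}. d1 0 j = 0 \<and> d1 m j = 0"
  shows "(\<Sum>p\<in>UNIV. osmosis_op1 m n pix h d1 u $ p) = 0"
proof -
  define U where "U = grid_val m n pix u"
  define F where "F i j = (U (i + 1) j - U i j) / h\<^sup>2 - 1 / h * (d1 i j * ((U (i + 1) j + U i j) / 2))"
    for i j
  have "(\<Sum>p\<in>UNIV. osmosis_op1 m n pix h d1 u $ p)
      = (\<Sum>p\<in>UNIV. case pix p of (i, j) \<Rightarrow> F i j - F (i - 1) j)"
  proof (rule sum.cong[OF refl])
    fix p
    obtain i j where ij: "pix p = (i, j)" by fastforce
    then have "1 \<le> i" using bij_betwE[OF pix, rule_format, of p] by simp
    then show "osmosis_op1 m n pix h d1 u $ p = (case pix p of (i, j) \<Rightarrow> F i j - F (i - 1) j)"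
      by (simp add: osmosis_op1_def ij Let_def U_def[symmetric] F_def)
         (simp add: add_divide_distrib diff_divide_distrib algebra_simps)
  qed
  also have "\<dots> = (\<Sum>(i, j)\<in>{1..m} \<times> {1..n}. F i j - F (i - 1) j)"
    by (rule sum.reindex_bij_betw[OF pix])
  also have "\<dots> = (\<Sum>j\<in>{1..n}. \<Sum>i\<in>{1..m}. F i j - F (i - 1) j)"
    by (subst sum.swap) (simp add: sum.cartesian_product)
  also have "\<dots> = (\<Sum>j\<in>{1..n}. 0)"
  proof (rule sum.cong[OF refl])
    fix j assume j: "j \<in> {1..n}"
    have "F 0 j = 0" "F m j = 0"
      using bd j by (auto simp: F_def U_def grid_val_def max_def min_def)
    moreover have "(\<Sum>i\<in>{1..m}. F i j - F (i - 1) j) = F m j - F 0 j"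
      by (induction m) auto
    ultimately show "(\<Sum>i\<in>{1..m}. F i j - F (i - 1) j) = 0" by simp
  qed
  finally show ?thesis by simp
qed

lemma osmosis_op1_column_sum_eq_0:
  assumes "bij_betw pix UNIV ({1..m} \<times> {1..n})" "\<forall>j\<in>{1..n}. d1 0 j = 0 \<and> d1 m j = 0"
  shows "(\<Sum>p\<in>UNIV. matrix (osmosis_op1 m n pix h d1) $ p $ q) = 0"
  using osmosis_op1_sum_eq_0[OF assms, of h "axis q 1"] by (simp add: matrix_def)

lemma osmosis_op1_same_line:
  assumes pix: "bij_betw pix UNIV ({1..m} \<times> {1..n})"
    and nz: "matrix (osmosis_op1 m n pix h d1) $ p $ q \<noteq> 0"
  shows "snd (pix p) = snd (pix q)"
proof (rule ccontr)
  assume ne: "snd (pix p) \<noteq> snd (pix q)"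
  obtain i j where ij: "pix p = (i, j)" by fastforce
  then have range: "1 \<le> i" "i \<le> m" "1 \<le> j" "j \<le> n"
    using bij_betwE[OF pix, rule_format, of p] by simp_all
  have "grid_val m n pix (axis q 1) i' j = 0" for i'
  proof -
    have "(max 1 (min m i'), j) \<in> range pix"
      using bij_betw_imp_surj_on[OF pix] range by auto
    then have "pix (inv pix (max 1 (min m i'), j)) = (max 1 (min m i'), j)"
      by (rule f_inv_into_f)
    then have "inv pix (max 1 (min m i'), j) \<noteq> q"
      using ne ij by auto
    then show ?thesis
      using range by (simp add: grid_val_def axis_def)
  qed
  then have "osmosis_op1 m n pix h d1 (axis q 1) $ p = 0"
    by (simp add: osmosis_op1_def ij)
  with nz show False by (simp add: matrix_def)
qed

text \<open>
  The sign condition on the sum passes to both summands, as no off-diagonal position can be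
  nonzero in both: two distinct pixels cannot share both indices.
\<close>

lemma osmosis_generators:
  fixes pix :: "'p::finite \<Rightarrow> nat \<times> nat"
  assumes pix: "bij_betw pix UNIV ({1..m} \<times> {1..n})"
    and bd1: "\<forall>j\<in>{1..n}. d1 0 j = 0 \<and> d1 m j = 0"
    and bd2: "\<forall>i\<in>{1..m}. d2 i 0 = 0 \<and> d2 i n = 0"
    and A1: "A1 = matrix (osmosis_op1 m n pix h d1)"
    and A2: "A2 = matrix (osmosis_op2 m n pix h d2)"
    and off: "\<forall>p q. p \<noteq> q \<longrightarrow> (A1 + A2) $ p $ q \<ge> 0"
  shows "markov_generator A1" "markov_generator A2"
proof -
  have pix': "bij_betw (prod.swap \<circ> pix) UNIV ({1..n} \<times> {1..m})"
    using pix by (rule bij_betw_trans) (auto simp: bij_betw_def inj_on_def image_iff)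
  have disjoint: "A1 $ p $ q = 0 \<or> A2 $ p $ q = 0" if "p \<noteq> q" for p q
  proof (rule ccontr)
    assume "\<not> ?thesis"
    then have "snd (pix p) = snd (pix q)" "fst (pix p) = fst (pix q)"
      using osmosis_op1_same_line[OF pix, of h d1 p q]
        osmosis_op1_same_line[OF pix', of h "\<lambda>j i. d2 i j" p q]
      by (auto simp: A1 A2 osmosis_op2_eq_op1_swap)
    then have "pix p = pix q" by (simp add: prod_eq_iff)
    with \<open>p \<noteq> q\<close> show False
      using bij_betw_imp_inj_on[OF pix] by (auto dest: injD)
  qed
  have "0 \<le> A1 $ p $ q" "0 \<le> A2 $ p $ q" if "p \<noteq> q" for p q
    using disjoint[OF that] off that by (metis add_0 add.right_neutral order_refl vector_add_component)+
  moreover have "(\<Sum>p\<in>UNIV. A1 $ p $ q) = 0" for q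
    unfolding A1 using pix bd1 by (rule osmosis_op1_column_sum_eq_0)
  moreover have "(\<Sum>p\<in>UNIV. A2 $ p $ q) = 0" for q
    unfolding A2 osmosis_op2_eq_op1_swap using pix' bd2 by (rule osmosis_op1_column_sum_eq_0)
  ultimately show "markov_generator A1" "markov_generator A2"
    by (auto simp: markov_generator_def)
qed

text \<open>
  The maximum \<open>M\<close> is positive here, as otherwise \<open>inverse M \<le> 0\<close> (with \<open>inverse 0 = 0\<close>) would
  leave no room for a positive \<open>\<tau>\<close>.
\<close>

lemma step_size_bound:
  fixes a b :: "'p::finite \<Rightarrow> real"
  assumes "0 < \<tau>" and "\<tau> < 2 * inverse (max (MAX p. \<bar>a p\<bar>) (MAX p. \<bar>b p\<bar>))"
  shows "\<tau> / 2 * \<bar>a p\<bar> < 1" "\<tau> / 2 * \<bar>b p\<bar> < 1"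
proof -
  define M where "M = max (MAX p. \<bar>a p\<bar>) (MAX p. \<bar>b p\<bar>)"
  have \<tau>: "\<tau> < 2 * inverse M" using assms(2) by (simp add: M_def)
  then have "0 < inverse M" using assms(1) by linarith
  then have "0 < M" by simp
  then have bound: "\<tau> / 2 * M < 1" using \<tau> by (simp add: field_simps)
  have "\<bar>a p\<bar> \<le> M" "\<bar>b p\<bar> \<le> M"
    unfolding M_def by (auto intro: max.coboundedI1 max.coboundedI2)
  then have "\<tau> / 2 * \<bar>a p\<bar> \<le> \<tau> / 2 * M" "\<tau> / 2 * \<bar>b p\<bar> \<le> \<tau> / 2 * M"
    using assms(1) by (auto intro: mult_left_mono)
  with bound show "\<tau> / 2 * \<bar>a p\<bar> < 1" "\<tau> / 2 * \<bar>b p\<bar> < 1" by linarith+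
qed

section \<open>Mass conservation, positivity and convergence\<close>

theorem proposition1:
  fixes m n :: nat
    and pix :: "'p::finite \<Rightarrow> nat \<times> nat"
    and h \<tau> :: real
    and d1 d2 :: "nat \<Rightarrow> nat \<Rightarrow> real"
    and A1 A2 A :: "real ^ 'p ^ 'p"
    and f :: "real ^ 'p"
  assumes "m \<ge> 1" and "n \<ge> 1" and "m * n \<ge> 2"
    and "bij_betw pix UNIV ({1..m} \<times> {1..n})"
    and "h > 0"
    and "\<forall>j\<in>{1..n}. d1 0 j = 0 \<and> d1 m j = 0"
    and "\<forall>i\<in>{1..m}. d2 i 0 = 0 \<and> d2 i n = 0"
    and "A1 = matrix (osmosis_op1 m n pix h d1)"
    and "A2 = matrix (osmosis_op2 m n pix h d2)"
    and "A = A1 + A2"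
    and "irreducible_mat A"
    and "\<forall>p q. p \<noteq> q \<longrightarrow> A $ p $ q \<ge> 0"
    and "\<forall>p. f $ p > 0"
    and "0 < \<tau>"
    and "\<tau> < 2 * inverse (max (MAX p. \<bar>A1 $ p $ p\<bar>) (MAX p. \<bar>A2 $ p $ p\<bar>))"
  shows "(\<exists>!(u, v). peaceman_rachford \<tau> A1 A2 f u v) \<and>
    (\<forall>u v. peaceman_rachford \<tau> A1 A2 f u v \<longrightarrow>
       (\<forall>k. average (u k) = average f) \<and>
       (\<forall>k p. u k $ p > 0) \<and>
       (\<exists>w. u \<longlonglongrightarrow> w \<and>
            steady_state (pr_matrix \<tau> A1 A2) w \<and> average w = average f \<and>
            (\<forall>w'. steady_state (pr_matrix \<tau> A1 A2) w' \<and> average w' = average f \<longrightarrow> w' = w)))"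
proof -
  define P where "P = pr_matrix \<tau> A1 A2"
  define R where "R = Id \<union> {(p, q). A1 $ p $ q \<noteq> 0 \<or> A2 $ p $ q \<noteq> 0}"
  have gen: "markov_generator A1" "markov_generator A2"
    using osmosis_generators[OF assms(4,6,7,8,9)] assms(10,12) by auto
  have stoch: "column_stochastic P" and pos: "positive_on R P"
    unfolding P_def R_def
    using pr_matrix_stochastic[OF gen assms(14) step_size_bound[OF assms(14,15)]] .
  have "Id \<subseteq> R" by (auto simp: R_def)
  have "{(p, q). A $ p $ q \<noteq> 0} \<subseteq> R" by (auto simp: R_def assms(10))
  then have "{(p, q). A $ p $ q \<noteq> 0}\<^sup>* \<subseteq> R\<^sup>*" by (rule rtrancl_mono)
  then have "R\<^sup>* = UNIV"
    using assms(11) by (auto simp: irreducible_mat_def)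
  have "0 \<le> \<tau> / 2" using assms(14) by simp
  note PR = peaceman_rachford_iff[OF resolvent_invertible[OF gen(1) this]
      resolvent_invertible[OF gen(2) this], folded P_def]
  have avg_iff: "average x = average y \<longleftrightarrow> (\<Sum>p\<in>UNIV. x $ p) = (\<Sum>p\<in>UNIV. y $ p)"
    for x y :: "real ^ 'p"
    by (simp add: average_def)
  have power_sum: "average (mat_power P k *v f) = average f" for k
    unfolding avg_iff by (rule column_stochastic_sum[OF column_stochastic_mat_power[OF stoch]])
  have power_pos: "0 < (mat_power P k *v f) $ p" for k p
  proof (induction k arbitrary: p)
    case 0
    show ?case using assms(13) by simp
  next
    case (Suc k)
    show ?case
      using column_stochastic_preserves_positive[OF stoch positive_on_mono[OF pos \<open>Id \<subseteq> R\<close>]] Suc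
      by (simp add: matrix_vector_mul_assoc[symmetric])
  qed
  obtain w where w: "P *v w = w" "average w = average f"
    and lim: "\<And>x. average x = average f \<Longrightarrow> (\<lambda>k. mat_power P k *v x) \<longlonglongrightarrow> w"
    using column_stochastic_powers_tendsto[OF stoch pos \<open>Id \<subseteq> R\<close> \<open>R\<^sup>* = UNIV\<close>,
        of "\<Sum>p\<in>UNIV. f $ p"] unfolding avg_iff by blast
  have unique: "w' = w" if "P *v w' = w'" "average w' = average f" for w'
    using lim[OF that(2)] by (simp add: mat_power_fixed[OF that(1)] LIMSEQ_const_iff)
  have "\<exists>!(u, v). peaceman_rachford \<tau> A1 A2 f u v"
    unfolding PR by auto
  moreover have "(\<forall>k. average (u k) = average f) \<and> (\<forall>k p. u k $ p > 0) \<and>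
      (\<exists>w. u \<longlonglongrightarrow> w \<and> steady_state P w \<and> average w = average f \<and>
        (\<forall>w'. steady_state P w' \<and> average w' = average f \<longrightarrow> w' = w))"
    if "peaceman_rachford \<tau> A1 A2 f u v" for u v
  proof -
    have u: "u = (\<lambda>k. mat_power P k *v f)" using that by (simp add: PR)
    show ?thesis
      using power_sum power_pos w lim[OF refl] unique
      unfolding u steady_state_def by blast
  qed
  ultimately show ?thesis unfolding P_def by blast
qed

end
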